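(* Let $H$ be a finite simple graph with $|V(H)|=n$, let $G=W(H)$ be its whisker graph, and let $q$ be an integer with $1\le q\le \nu(G)$. If $H$ has no odd cycle, then $\mathsf{MF}^q(G)$ is pure. Otherwise, let $\ell$ be the length of the smallest odd cycle in $H$. Then $\mathsf{MF}^q(G)$ is pure if and only if $$1\le q<\Big\lceil \frac{\ell}{2}\Big\rceil \quad\text{or}\quad n-\Big\lfloor \frac{\ell}{2}\Big\rfloor<q\le \nu(G).$$
   Context: For a finite simple graph $H$ with vertices $x_1,\dots,x_n$, the whisker graph $W(H)$ has vertex set $\{x_1,\dots,x_n,y_1,\dots,y_n\}$ (the $y_i$ being new vertices) and edge set $E(H)\cup\{\{x_i,y_i\}: 1\le i\le n\}$. The matching number $\nu(G)$ is the maximum size of a set of pairwise disjoint edges of $G$. For a finite simple graph $G$ and an integer $q\ge1$, the $q$-matching-free complex $\mathsf{MF}^q(G)$ is the simplicial complex on $V(G)$ whose faces are the subsets $F\subseteq V(G)$ such that the induced subgraph $G[F]$ contains no matching of size $q$. A simplicial complex is pure if all its facets (maximal faces) have the same dimension, where $\dim F=|F|-1$. *)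

theory Defs
  imports Complex_Main
begin

datatype 'a graph = Graph (verts: "'a set") (edges: "'a set set")

definition finite_simple_graph :: "'a graph \<Rightarrow> bool" where
  "finite_simple_graph G \<longleftrightarrow>
     finite (verts G) \<and> (\<forall>e \<in> edges G. e \<subseteq> verts G \<and> card e = 2)"

definition induced_subgraph :: "'a graph \<Rightarrow> 'a set \<Rightarrow> 'a graph" where
  "induced_subgraph G F = Graph F {e \<in> edges G. e \<subseteq> F}"

text \<open>The vertex \<open>Inl x\<close> is the original vertex \<open>x\<close>, and \<open>Inr x\<close> is the new vertex attached to it.\<close>

definition whisker_graph :: "'a graph \<Rightarrow> ('a + 'a) graph" where
  "whisker_graph H =
     Graph (Inl ` verts H \<union> Inr ` verts H)
           ((\<lambda>e. Inl ` e) ` edges H \<union> {{Inl x, Inr x} | x. x \<in> verts H})"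

definition matching :: "'a graph \<Rightarrow> 'a set set \<Rightarrow> bool" where
  "matching G M \<longleftrightarrow> M \<subseteq> edges G \<and> pairwise disjnt M"

definition matching_number :: "'a graph \<Rightarrow> nat" where
  "matching_number G = Max (card ` {M. matching G M})"

text \<open>A cycle is given by the list of its vertices, without repeating the first one at the end.\<close>

definition cycle :: "'a graph \<Rightarrow> 'a list \<Rightarrow> bool" where
  "cycle G c \<longleftrightarrow>
     3 \<le> length c \<and> distinct c \<and> set c \<subseteq> verts G \<and>
     (\<forall>i < length c. {c ! i, c ! (Suc i mod length c)} \<in> edges G)"

definition has_odd_cycle :: "'a graph \<Rightarrow> bool" where
  "has_odd_cycle G \<longleftrightarrow> (\<exists>c. cycle G c \<and> odd (length c))"

text \<open>Only meaningful for graphs that have an odd cycle.\<close>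

definition odd_girth :: "'a graph \<Rightarrow> nat" where
  "odd_girth G = (LEAST l. \<exists>c. cycle G c \<and> odd (length c) \<and> length c = l)"

text \<open>Simplicial complexes are represented by their sets of faces.\<close>

definition matching_free_complex :: "nat \<Rightarrow> 'a graph \<Rightarrow> 'a set set" where
  "matching_free_complex q G =
     {F. F \<subseteq> verts G \<and> \<not> (\<exists>M. matching (induced_subgraph G F) M \<and> card M = q)}"

definition facets :: "'a set set \<Rightarrow> 'a set set" where
  "facets K = {F \<in> K. \<forall>F' \<in> K. F \<subseteq> F' \<longrightarrow> F' = F}"

definition face_dim :: "'a set \<Rightarrow> int" where
  "face_dim F = int (card F) - 1"

definition pure_complex :: "'a set set \<Rightarrow> bool" where
  "pure_complex K \<longleftrightarrow> (\<forall>F \<in> facets K. \<forall>F' \<in> facets K. face_dim F = face_dim F')"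

end

theory Submission
  imports Defs
begin

text \<open>
  Let \<open>V\<close> be the vertex set of \<open>H\<close> and \<open>n\<close> its size. A facet \<open>F\<close> of the complex meets every whisker
  \<open>{x, x'}\<close>, since a leaf \<open>x'\<close> without its neighbour \<open>x\<close> is isolated. Hence \<open>card F = n + card A\<close>, where
  \<open>A\<close> is the set of those \<open>x\<close> for which \<open>F\<close> contains both ends of the whisker. The whiskers over \<open>A\<close> form a
  matching, so \<open>card A \<le> q - 1\<close>, and taking all leaves together with \<open>q - 1\<close> vertices of \<open>H\<close> gives a facet
  where equality holds. So the complex is pure iff \<open>card A = q - 1\<close> for every facet
  (\<open>pure_iff_full_pairs\<close>).

  Purity then turns out to fail exactly when \<open>H\<close> has a cycle of some odd length \<open>2 * m + 1\<close> with
  \<open>m < q \<le> n - m\<close>. The range of such \<open>q\<close> is largest for the shortest odd cycle, which gives the theorem.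

  From a cycle to a small facet (\<open>not_pure_of_odd_cycle\<close>): let \<open>B\<close> be the vertex set of the cycle, take
  \<open>q - 1 - m\<close> vertices \<open>A\<close> outside \<open>B\<close>, and let \<open>F\<close> consist of \<open>A\<close>, \<open>B\<close> and all leaves not attached to
  \<open>B\<close>. A matching in \<open>F\<close> has at most \<open>card A\<close> edges at \<open>A\<close> and at most \<open>m\<close> edges inside the odd set \<open>B\<close>. As an
  odd cycle minus any vertex has a perfect matching, a new leaf at a vertex of \<open>B\<close>, or a new vertex of \<open>H\<close>,
  always contributes a \<open>q\<close>-th edge.

  From a small facet to a cycle (\<open>odd_cycle_of_not_pure\<close>): suppose \<open>card A < q - 1\<close>, and call \<open>B\<close> the set of
  vertices of \<open>H\<close> in \<open>F\<close> whose leaf is not in \<open>F\<close>. Adding a vertex to \<open>F\<close> creates a matching of size \<open>q\<close>, so the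
  maximum matchings in \<open>F\<close> have \<open>q - 1\<close> edges, and each vertex of \<open>B\<close> is missed by one of them. If \<open>B\<close> were
  independent, \<open>A\<close> would be a vertex cover with fewer than \<open>q - 1\<close> vertices; so there are adjacent \<open>u\<close> and \<open>v\<close> in
  \<open>B\<close>. Maximum matchings \<open>M\<close> missing \<open>u\<close> and \<open>N\<close> missing \<open>v\<close> yield an even alternating path from \<open>u\<close> to \<open>v\<close>
  (\<open>alternating_path\<close>), as in Gallai's lemma, and \<open>{u, v}\<close> closes it to an odd cycle of length \<open>2 * m + 1\<close>. It
  lies in \<open>H\<close>, because leaves have degree one. The matching \<open>M\<close> contains \<open>m\<close> edges of the cycle, so
  \<open>m \<le> q - 1\<close>. Each edge of \<open>M\<close> uses a vertex of \<open>H\<close>, these \<open>m\<close> edges use two, and \<open>u\<close> is not used; so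
  \<open>(q - 1) + m \<le> n - 1\<close>.
\<close>

section \<open>Matchings in finite simple graphs\<close>

lemma finite_edges:
  assumes "finite_simple_graph G" shows "finite (edges G)"
proof -
  have "edges G \<subseteq> Pow (verts G)" using assms by (auto simp: finite_simple_graph_def)
  then show ?thesis using assms finite_subset by (auto simp: finite_simple_graph_def)
qed

lemma edge_nonempty:
  assumes "finite_simple_graph G" "e \<in> edges G" shows "e \<noteq> {}"
  using assms by (auto simp: finite_simple_graph_def)

lemma edge_endpoints_distinct:
  assumes "finite_simple_graph G" "{x, y} \<in> edges G" shows "x \<noteq> y"
  using assms by (auto simp: finite_simple_graph_def)

lemma edge_other_endpoint:
  assumes "finite_simple_graph G" "e \<in> edges G" "x \<in> e"
  obtains y where "e = {x, y}" "x \<noteq> y"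
proof -
  have "card e = 2" using assms by (auto simp: finite_simple_graph_def)
  then obtain a b where "e = {a, b}" "a \<noteq> b" by (auto simp: card_2_iff)
  then show thesis using that assms(3) by blast
qed

lemma matching_finite:
  assumes "finite_simple_graph G" "matching G M" shows "finite M"
  using assms finite_edges finite_subset by (auto simp: matching_def)

lemma matching_subset:
  assumes "matching G M" "M' \<subseteq> M" shows "matching G M'"
  using assms by (auto simp: matching_def intro: pairwise_subset)

lemma matching_edge_unique:
  assumes "matching G M" "e \<in> M" "f \<in> M" "x \<in> e" "x \<in> f" shows "e = f"
  using assms unfolding matching_def by (metis disjnt_iff pairwiseD)

lemma matching_Un:
  assumes "matching G M" "matching G N" "\<Union>M \<inter> \<Union>N = {}"
  shows "matching G (M \<union> N)"
  unfolding matching_def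
proof (intro conjI pairwiseI)
  show "M \<union> N \<subseteq> edges G" using assms by (auto simp: matching_def)
  have across: "disjnt e f" if "e \<in> M" "f \<in> N" for e f
    using assms(3) that unfolding disjnt_def by blast
  fix e f assume "e \<in> M \<union> N" "f \<in> M \<union> N" "e \<noteq> f"
  then show "disjnt e f"
    using assms(1,2) across by (auto simp: matching_def pairwise_def disjnt_sym)
qed

lemma card_matching_Un:
  assumes "finite_simple_graph G" "matching G M" "matching G N" "\<Union>M \<inter> \<Union>N = {}"
  shows "card (M \<union> N) = card M + card N"
proof -
  have "M \<inter> N = {}"
  proof (rule ccontr)
    assume "M \<inter> N \<noteq> {}"
    then obtain e where e: "e \<in> M" "e \<in> N" by blast
    then have "e \<in> edges G" using assms(2) by (auto simp: matching_def)
    then have "e \<noteq> {}" using edge_nonempty assms(1) by blast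
    then show False using e assms(4) by blast
  qed
  then show ?thesis using assms matching_finite by (intro card_Un_disjoint) blast+
qed

lemma matching_insert:
  assumes "finite_simple_graph G" "matching G M" "e \<in> edges G" "e \<inter> \<Union>M = {}"
  shows "matching G (insert e M)" "card (insert e M) = Suc (card M)"
proof -
  have e: "matching G {e}" using assms by (auto simp: matching_def)
  show "matching G (insert e M)" using matching_Un[OF e assms(2)] assms(4) by auto
  show "card (insert e M) = Suc (card M)"
    using card_matching_Un[OF assms(1) e assms(2)] assms(4) by auto
qed

text \<open>Weak duality: a matching has at most as many edges as a vertex cover has vertices, since
  distinct edges pick distinct vertices of the cover.\<close>

lemma card_matching_le_cover:
  assumes "matching G M" "finite C" "\<And>e. e \<in> M \<Longrightarrow> e \<inter> C \<noteq> {}"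
  shows "card M \<le> card C"
proof -
  define f where "f e = (SOME x. x \<in> e \<inter> C)" for e
  have f: "f e \<in> e \<inter> C" if "e \<in> M" for e
    unfolding f_def using assms(3)[OF that] by (metis ex_in_conv someI_ex)
  have "inj_on f M" using f matching_edge_unique[OF assms(1)] by (metis IntD1 inj_onI)
  then show ?thesis using f assms(2) by (intro card_inj_on_le[of f]) auto
qed

text \<open>Counts the matched vertices in \<open>X\<close> edge by edge; edges with both ends in \<open>X\<close> count twice.\<close>

lemma card_Union_matching:
  assumes "finite_simple_graph G" "matching G M"
  shows "card (\<Union>M \<inter> X) = (\<Sum>e\<in>M. card (e \<inter> X))"
proof -
  have fin: "finite e" if "e \<in> M" for e
    using assms that by (auto simp: finite_simple_graph_def matching_def intro: finite_subset)
  have "\<Union>M \<inter> X = (\<Union>e\<in>M. e \<inter> X)" by blast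
  also have "card \<dots> = (\<Sum>e\<in>M. card (e \<inter> X))"
    using fin matching_finite[OF assms] matching_edge_unique[OF assms(2)]
    by (intro card_UN_disjoint) blast+
  finally show ?thesis .
qed

lemma matching_induced_iff:
  "matching (induced_subgraph G F) M \<longleftrightarrow> matching G M \<and> \<Union>M \<subseteq> F"
  by (auto simp: matching_def induced_subgraph_def)

lemma finite_simple_graph_induced:
  assumes "finite_simple_graph G" "F \<subseteq> verts G"
  shows "finite_simple_graph (induced_subgraph G F)"
  using assms by (auto simp: finite_simple_graph_def induced_subgraph_def intro: finite_subset)

section \<open>Paths and cycles as lists\<close>

text \<open>Every other edge of the path, starting with its first edge; the last vertex stays single if the
  length is odd.\<close>

fun pair_up :: "'a list \<Rightarrow> 'a set set" where
  "pair_up (x # y # zs) = insert {x, y} (pair_up zs)"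
| "pair_up _ = {}"

lemma Union_pair_up_subset: "\<Union>(pair_up p) \<subseteq> set p"
  by (induction p rule: pair_up.induct) auto

lemma matching_pair_up:
  assumes "finite_simple_graph G" "distinct p" "successively (\<lambda>x y. {x, y} \<in> edges G) p"
  shows "matching G (pair_up p) \<and> card (pair_up p) = length p div 2"
  using assms(2,3)
proof (induction p rule: pair_up.induct)
  case (1 x y zs)
  have zs: "successively (\<lambda>x y. {x, y} \<in> edges G) zs"
    using "1.prems" by (cases zs) auto
  have "{x, y} \<inter> \<Union>(pair_up zs) = {}" using "1.prems" Union_pair_up_subset[of zs] by auto
  then show ?case using matching_insert[OF assms(1), of "pair_up zs" "{x, y}"] 1 zs by auto
qed (auto simp: matching_def)

lemma card_pair_up:
  assumes "distinct p" shows "card (pair_up p) = length p div 2"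
  using assms
proof (induction p rule: pair_up.induct)
  case (1 x y zs)
  have "{x, y} \<notin> pair_up zs" using "1.prems" Union_pair_up_subset[of zs] by auto
  moreover have "finite (pair_up zs)" by (induction zs rule: pair_up.induct) auto
  ultimately show ?case using 1 by auto
qed auto

lemma cycleI:
  assumes "3 \<le> length c" "distinct c" "set c \<subseteq> verts G"
    and succ: "successively (\<lambda>x y. {x, y} \<in> edges G) c" and close: "{last c, hd c} \<in> edges G"
  shows "cycle G c"
  unfolding cycle_def
proof (intro conjI allI impI)
  fix i assume i: "i < length c"
  show "{c ! i, c ! (Suc i mod length c)} \<in> edges G"
  proof (cases "Suc i = length c")
    case True
    have "c \<noteq> []" using assms(1) by auto
    moreover have "i = length c - 1" using True by simp
    ultimately have "c ! i = last c" "c ! (Suc i mod length c) = hd c"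
      using True by (auto simp: last_conv_nth hd_conv_nth)
    then show ?thesis using close by simp
  next
    case False
    then show ?thesis using i succ by (auto simp: successively_conv_nth)
  qed
qed (use assms in auto)

text \<open>Rotating the cycle so that it starts at \<open>x\<close> and dropping \<open>x\<close> leaves a path. For an odd cycle this
  path has a perfect matching, given by \<open>pair_up\<close>.\<close>

lemma cycle_path_avoiding_vertex:
  assumes "cycle G c" "x \<in> set c"
  obtains p where "distinct p" "set p = set c - {x}" "successively (\<lambda>x y. {x, y} \<in> edges G) p"
    "length p = length c - 1"
proof -
  obtain j where j: "j < length c" "c ! j = x" using assms(2) by (auto simp: in_set_conv_nth)
  define r where "r = rotate j c"
  have c: "distinct c" "3 \<le> length c" "\<forall>i<length c. {c ! i, c ! (Suc i mod length c)} \<in> edges G"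
    using assms(1) by (auto simp: cycle_def)
  have "c \<noteq> []" using j by auto
  have r: "distinct r" "set r = set c" "length r = length c" "r \<noteq> []" "hd r = x"
    using c j \<open>c \<noteq> []\<close> by (auto simp: r_def hd_rotate_conv_nth)
  have "{r ! i, r ! Suc i} \<in> edges G" if i: "Suc i < length r" for i
  proof -
    let ?k = "(j + i) mod length c"
    have "?k < length c" using \<open>c \<noteq> []\<close> by simp
    moreover have "r ! i = c ! ?k" "r ! Suc i = c ! (Suc ?k mod length c)"
      using i r by (auto simp: r_def nth_rotate mod_Suc_eq)
    ultimately show ?thesis using c by metis
  qed
  then have "successively (\<lambda>x y. {x, y} \<in> edges G) r" by (simp add: successively_conv_nth)
  moreover have "r = x # tl r" using r by (cases r) auto
  ultimately have "distinct (x # tl r)" "set (x # tl r) = set c"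
      "successively (\<lambda>x y. {x, y} \<in> edges G) (x # tl r)"
    using r by metis+
  then have "distinct (tl r)" "set (tl r) = set c - {x}"
      "successively (\<lambda>x y. {x, y} \<in> edges G) (tl r)"
    by (auto simp: successively_Cons)
  then show thesis using that r by simp
qed

section \<open>Alternating paths\<close>

text \<open>Two maximum matchings \<open>M\<close> missing \<open>u\<close> and \<open>N\<close> missing \<open>v\<close> either leave room for a maximum matching
  missing both, or the component of \<open>u\<close> in their symmetric difference is a path ending at \<open>v\<close>.

  The induction follows this path from \<open>u\<close> without forming the component. If \<open>{u, a}\<close> is the \<open>N\<close>-edge at \<open>u\<close>
  and \<open>{a, w}\<close> the \<open>M\<close>-edge at \<open>a\<close>, exchanging the latter for the former in \<open>M\<close> gives a maximum matching \<open>M'\<close>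
  that misses \<open>w\<close> and is closer to \<open>N\<close>. The conclusions about \<open>M \<inter> N\<close> carry the induction: \<open>{u, a}\<close> lies in
  \<open>M' \<inter> N\<close>, hence a path obtained for \<open>M'\<close> avoids \<open>u\<close> and \<open>a\<close> and can be prolonged by them, while a
  matching obtained for \<open>M'\<close> contains \<open>{u, a}\<close>, so the exchange can be undone in it.\<close>

lemma alternating_path:
  assumes G: "finite_simple_graph G"
    and N: "matching G N" "card N = s" "v \<notin> \<Union>N"
    and maximum: "\<And>M'. matching G M' \<Longrightarrow> card M' \<le> s"
    and M: "matching G M" "card M = s" "u \<notin> \<Union>M"
    and "u \<noteq> v"
  shows "(\<exists>N'. matching G N' \<and> card N' = s \<and> M \<inter> N \<subseteq> N' \<and> u \<notin> \<Union>N' \<and> v \<notin> \<Union>N') \<or>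
    (\<exists>p. p \<noteq> [] \<and> last p = v \<and> even (length p) \<and> distinct (u # p) \<and>
      successively (\<lambda>x y. {x, y} \<in> M \<union> N) (u # p) \<and> pair_up p \<subseteq> M \<and>
      set (u # p) \<inter> \<Union>(M \<inter> N) = {})"
  using M \<open>u \<noteq> v\<close>
proof (induction "card (M - N)" arbitrary: M u rule: less_induct)
  case less
  show ?case
  proof (cases "u \<in> \<Union>N")
    case False
    then show ?thesis using N by blast
  next
    case True
    then obtain e where e: "e \<in> N" "u \<in> e" by blast
    then have eG: "e \<in> edges G" using N by (auto simp: matching_def)
    then obtain a where a: "e = {u, a}" "u \<noteq> a" using edge_other_endpoint[OF G] e by metis
    \<comment> \<open>Otherwise \<open>M\<close> could be enlarged by \<open>e\<close>.\<close>
    have "a \<in> \<Union>M"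
    proof (rule ccontr)
      assume "a \<notin> \<Union>M"
      then have "e \<inter> \<Union>M = {}" using a less.prems by auto
      then show False
        using matching_insert[OF G less.prems(1) eG] maximum[of "insert e M"] less.prems by simp
    qed
    then obtain f where f: "f \<in> M" "a \<in> f" by blast
    then have fG: "f \<in> edges G" using less.prems by (auto simp: matching_def)
    then obtain w where w: "f = {a, w}" "a \<noteq> w" using edge_other_endpoint[OF G] f by metis
    have "w \<noteq> u" "e \<notin> M" using w f e less.prems by auto
    have "a \<noteq> v" using a e N by auto
    have fN: "f \<notin> N"
      using matching_edge_unique[OF N(1) e(1), of f a] a w \<open>w \<noteq> u\<close> by (auto simp: doubleton_eq_iff)
    have only_f: "x \<notin> \<Union>(M - {f})" if "x \<in> f" for x
      using matching_edge_unique[OF less.prems(1) f(1)] that by blast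
    have only_e: "x \<notin> \<Union>(N - {e})" if "x \<in> e" for x
      using matching_edge_unique[OF N(1) e(1)] that by blast
    define M' where "M' = insert e (M - {f})"
    have finM: "finite M" using matching_finite[OF G] less.prems by blast
    have sub: "matching G (M - {f})" using matching_subset less.prems by blast
    have "e \<inter> \<Union>(M - {f}) = {}" using a w only_f less.prems by auto
    from matching_insert[OF G sub eG this]
    have M': "matching G M'" "card M' = s"
      using card_Suc_Diff1[OF finM f(1)] less.prems by (simp_all add: M'_def)
    have wM': "w \<notin> \<Union>M'" using only_f w a \<open>w \<noteq> u\<close> by (auto simp: M'_def)
    have MN: "M \<inter> N \<subseteq> M' \<inter> N" "e \<in> M' \<inter> N" using fN e by (auto simp: M'_def)
    have avoid: "{u, a} \<inter> \<Union>(M \<inter> N) = {}" using less.prems only_f[of a] f fN by blast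
    show ?thesis
    proof (cases "w = v")
      case True
      have "v \<notin> \<Union>(M \<inter> N)" using N by blast
      then have "[a, v] \<noteq> [] \<and> last [a, v] = v \<and> even (length [a, v]) \<and> distinct (u # [a, v]) \<and>
        successively (\<lambda>x y. {x, y} \<in> M \<union> N) (u # [a, v]) \<and> pair_up [a, v] \<subseteq> M \<and>
        set (u # [a, v]) \<inter> \<Union>(M \<inter> N) = {}"
        using a w e f True avoid less.prems by auto
      then show ?thesis by blast
    next
      case False
      have "M' - N = (M - N) - {f}" using e by (auto simp: M'_def)
      moreover have "f \<in> M - N" using f fN by blast
      ultimately have "card (M' - N) < card (M - N)" using finM by (metis card_Diff1_less finite_Diff)
      from less.hyps[OF this M' wM' False] show ?thesis
      proof (elim disjE exE conjE)
        fix N' assume N': "matching G N'" "card N' = s" "M' \<inter> N \<subseteq> N'" "w \<notin> \<Union>N'" "v \<notin> \<Union>N'"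
        \<comment> \<open>Undo the exchange: this frees \<open>u\<close>, and \<open>w\<close> is available because \<open>N'\<close> misses it.\<close>
        define N'' where "N'' = insert f (N' - {e})"
        have eN': "e \<in> N'" using N' MN by blast
        have only_e': "x \<notin> \<Union>(N' - {e})" if "x \<in> e" for x
          using matching_edge_unique[OF N'(1) eN'] that by blast
        have sub': "matching G (N' - {e})" using matching_subset N' by blast
        have "f \<inter> \<Union>(N' - {e}) = {}" using a w only_e' N' by auto
        from matching_insert[OF G sub' fG this]
        have "matching G N''" "card N'' = s"
          using card_Suc_Diff1[OF matching_finite[OF G N'(1)] eN'] N'(2) by (simp_all add: N''_def)
        moreover have "M \<inter> N \<subseteq> N''" using N' MN \<open>e \<notin> M\<close> by (auto simp: N''_def)
        moreover have "u \<notin> \<Union>N''" "v \<notin> \<Union>N''"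
          using only_e' a w \<open>w \<noteq> u\<close> N' False \<open>a \<noteq> v\<close> by (auto simp: N''_def)
        ultimately show ?thesis by blast
      next
        fix p assume p: "p \<noteq> []" "last p = v" "even (length p)" "distinct (w # p)"
          "successively (\<lambda>x y. {x, y} \<in> M' \<union> N) (w # p)" "pair_up p \<subseteq> M'"
          "set (w # p) \<inter> \<Union>(M' \<inter> N) = {}"
        have ua: "u \<notin> set (w # p)" "a \<notin> set (w # p)" using p(7) MN(2) a by blast+
        have "successively (\<lambda>x y. {x, y} \<in> M \<union> N) (w # p)"
          using p(5) by (rule successively_mono) (use e in \<open>auto simp: M'_def\<close>)
        moreover have "e \<notin> pair_up p" using Union_pair_up_subset[of p] ua a by auto
        then have "pair_up p \<subseteq> M" using p(6) by (auto simp: M'_def)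
        moreover have "set (w # p) \<inter> \<Union>(M \<inter> N) = {}" using p(7) MN(1) by blast
        ultimately have "a # w # p \<noteq> [] \<and> last (a # w # p) = v \<and> even (length (a # w # p)) \<and>
          distinct (u # a # w # p) \<and> successively (\<lambda>x y. {x, y} \<in> M \<union> N) (u # a # w # p) \<and>
          pair_up (a # w # p) \<subseteq> M \<and> set (u # a # w # p) \<inter> \<Union>(M \<inter> N) = {}"
          using p ua a w e f avoid by auto
        then show ?thesis by blast
      qed
    qed
  qed
qed

text \<open>No maximum matching misses both ends of the edge \<open>{u, v}\<close>, as it could be enlarged by that edge. So the
  alternating path exists, and the edge closes it. The edges of \<open>M\<close> on the cycle \<open>u # p\<close> form
  \<open>pair_up p\<close>, since \<open>M\<close> misses \<open>u\<close>.\<close>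

lemma odd_cycle_of_missed_adjacent:
  assumes G: "finite_simple_graph G" and uv: "{u, v} \<in> edges G"
    and M: "matching G M" "card M = s" "u \<notin> \<Union>M"
    and N: "matching G N" "card N = s" "v \<notin> \<Union>N"
    and maximum: "\<And>M'. matching G M' \<Longrightarrow> card M' \<le> s"
  obtains p where "cycle G (u # p)" "even (length p)" "pair_up p \<subseteq> M"
proof -
  have "u \<noteq> v" using edge_endpoints_distinct[OF G uv] .
  have "\<not> (\<exists>N'. matching G N' \<and> card N' = s \<and> M \<inter> N \<subseteq> N' \<and> u \<notin> \<Union>N' \<and> v \<notin> \<Union>N')"
  proof clarify
    fix N' assume "matching G N'" "s = card N'" "u \<notin> \<Union>N'" "v \<notin> \<Union>N'"
    then show False
      using matching_insert[OF G _ uv, of N'] maximum[of "insert {u, v} N'"] by auto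
  qed
  with alternating_path[OF G N maximum M \<open>u \<noteq> v\<close>]
  obtain p where p: "p \<noteq> []" "last p = v" "even (length p)" "distinct (u # p)"
      "successively (\<lambda>x y. {x, y} \<in> M \<union> N) (u # p)" "pair_up p \<subseteq> M" by blast
  have succ: "successively (\<lambda>x y. {x, y} \<in> edges G) (u # p)"
    using p(5) by (rule successively_mono) (use M N in \<open>auto simp: matching_def\<close>)
  have "2 \<le> length p" using p(1,3) by (cases p; cases "tl p") auto
  moreover have "set (u # p) \<subseteq> verts G"
  proof
    fix x assume "x \<in> set (u # p)"
    then obtain i where i: "i < length (u # p)" "(u # p) ! i = x" by (metis in_set_conv_nth)
    show "x \<in> verts G"
    proof (cases "Suc i < length (u # p)")
      case True
      then have "{x, (u # p) ! Suc i} \<in> edges G" using succ i by (metis successively_conv_nth)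
      then show ?thesis using G by (auto simp: finite_simple_graph_def)
    next
      case False
      then have "i = length (u # p) - 1" using i by simp
      then have "x = last (u # p)" using i(2) last_conv_nth[of "u # p"] by simp
      then show ?thesis using p uv G by (auto simp: finite_simple_graph_def)
    qed
  qed
  moreover have "{last (u # p), hd (u # p)} \<in> edges G" using p uv by (simp add: insert_commute)
  ultimately have "cycle G (u # p)" using p succ by (intro cycleI) auto
  then show thesis using that p by blast
qed

section \<open>Facets of matching-free complexes\<close>

text \<open>Matchings can be thinned out, so having none of size \<open>q\<close> means that all are smaller.\<close>

lemma matching_free_complex_iff:
  assumes "finite_simple_graph G"
  shows "F \<in> matching_free_complex q G \<longleftrightarrow>
    F \<subseteq> verts G \<and> (\<forall>M. matching G M \<and> \<Union>M \<subseteq> F \<longrightarrow> card M < q)"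
proof -
  have "\<exists>M'. matching G M' \<and> \<Union>M' \<subseteq> F \<and> card M' = q"
    if M: "matching G M" "\<Union>M \<subseteq> F" and "\<not> card M < q" for M
  proof -
    obtain M' where "M' \<subseteq> M" "card M' = q" using obtain_subset_with_card_n \<open>\<not> card M < q\<close> by (metis not_less)
    then show ?thesis using matching_subset[OF M(1)] M(2) by blast
  qed
  then show ?thesis by (auto simp: matching_free_complex_def matching_induced_iff)
qed

lemma facetI:
  assumes G: "finite_simple_graph G" and F: "F \<in> matching_free_complex q G"
    and ex: "\<And>z. z \<in> verts G - F \<Longrightarrow> \<exists>M. matching G M \<and> \<Union>M \<subseteq> insert z F \<and> q \<le> card M"
  shows "F \<in> facets (matching_free_complex q G)"
proof -
  have "F' = F" if F': "F' \<in> matching_free_complex q G" "F \<subseteq> F'" for F'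
  proof (rule ccontr)
    assume "F' \<noteq> F"
    then obtain z where z: "z \<in> F'" "z \<notin> F" using F' by blast
    then have "z \<in> verts G - F" using F' by (auto simp: matching_free_complex_def)
    from ex[OF this] obtain M where "matching G M" "\<Union>M \<subseteq> insert z F" "q \<le> card M" by blast
    moreover from this have "\<Union>M \<subseteq> F'" using F' z by blast
    ultimately show False using F' matching_free_complex_iff[OF G] by (metis not_less)
  qed
  then show ?thesis using F by (auto simp: facets_def)
qed

text \<open>A vertex outside a facet creates a matching of size \<open>q\<close> when it is added. One edge \<open>e\<close> of that matching
  contains the vertex, and the others lie in the facet.\<close>

lemma facet_missing_vertex:
  assumes G: "finite_simple_graph G" and F: "F \<in> facets (matching_free_complex q G)"
    and z: "z \<in> verts G" "z \<notin> F"
  obtains M e where "matching G M" "\<Union>M \<subseteq> F" "Suc (card M) = q"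
    "e \<in> edges G" "z \<in> e" "e \<subseteq> insert z F" "e \<inter> \<Union>M = {}"
proof -
  have FK: "F \<in> matching_free_complex q G" using F by (auto simp: facets_def)
  have "insert z F \<notin> matching_free_complex q G" using F z by (auto simp: facets_def)
  then obtain M' where M': "matching G M'" "\<Union>M' \<subseteq> insert z F" "card M' = q"
    using FK z by (auto simp: matching_free_complex_def matching_induced_iff)
  have "z \<in> \<Union>M'"
  proof (rule ccontr)
    assume "z \<notin> \<Union>M'"
    then have "\<Union>M' \<subseteq> F" using M' by blast
    then show False using FK M' by (auto simp: matching_free_complex_def matching_induced_iff)
  qed
  then obtain e where e: "e \<in> M'" "z \<in> e" by blast
  have disj: "e \<inter> \<Union>(M' - {e}) = {}" using matching_edge_unique[OF M'(1) e(1)] by blast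
  show thesis
  proof (rule that[of "M' - {e}" e])
    show "matching G (M' - {e})" using M' matching_subset by blast
    show "\<Union>(M' - {e}) \<subseteq> F" using M' disj e by blast
    show "Suc (card (M' - {e})) = q" using M' e matching_finite[OF G] by (metis card_Suc_Diff1)
    show "e \<in> edges G" "e \<subseteq> insert z F" using M' e by (auto simp: matching_def)
  qed (use e disj in auto)
qed

section \<open>Whisker graphs\<close>

lemma verts_whisker: "verts (whisker_graph H) = Inl ` verts H \<union> Inr ` verts H"
  by (simp add: whisker_graph_def)

lemma whisker_edge_cases:
  assumes "e \<in> edges (whisker_graph H)"
  obtains e' where "e' \<in> edges H" "e = Inl ` e'" | x where "x \<in> verts H" "e = {Inl x, Inr x}"
  using assms by (auto simp: whisker_graph_def)

lemma whisker_edge: "x \<in> verts H \<Longrightarrow> {Inl x, Inr x} \<in> edges (whisker_graph H)"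
  by (auto simp: whisker_graph_def)

lemma finite_simple_graph_whisker:
  assumes "finite_simple_graph H" shows "finite_simple_graph (whisker_graph H)"
  unfolding finite_simple_graph_def
proof (intro conjI ballI)
  fix e assume "e \<in> edges (whisker_graph H)"
  then show "e \<subseteq> verts (whisker_graph H)" "card e = 2"
    using assms by (auto simp: finite_simple_graph_def verts_whisker card_image elim!: whisker_edge_cases)
qed (use assms in \<open>auto simp: finite_simple_graph_def verts_whisker\<close>)

lemma whisker_edge_through_Inr:
  assumes "e \<in> edges (whisker_graph H)" "Inr x \<in> e"
  shows "e = {Inl x, Inr x}"
  using assms by (auto elim: whisker_edge_cases)

lemma whisker_edge_Inl_iff:
  fixes H :: "'a graph"
  shows "{Inl x, Inl y} \<in> edges (whisker_graph H) \<longleftrightarrow> {x, y} \<in> edges H"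
proof
  assume "{Inl x, Inl y} \<in> edges (whisker_graph H)"
  then show "{x, y} \<in> edges H"
  proof (cases rule: whisker_edge_cases)
    case (1 e')
    then have "(Inl ` {x, y} :: ('a + 'a) set) = Inl ` e'" by simp
    then have "e' = {x, y}" by (metis inj_Inl inj_image_eq_iff)
    then show ?thesis using 1 by simp
  qed auto
next
  assume "{x, y} \<in> edges H"
  then have "Inl ` {x, y} \<in> edges (whisker_graph H)" unfolding whisker_graph_def graph.sel by blast
  then show "{Inl x, Inl y} \<in> edges (whisker_graph H)" by simp
qed

lemma whisker_edge_meets_verts:
  assumes "finite_simple_graph H" "e \<in> edges (whisker_graph H)"
  shows "e \<inter> Inl ` verts H \<noteq> {}"
  using assms(2)
proof (cases rule: whisker_edge_cases)
  case (1 e')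
  then have "e' \<noteq> {}" "e' \<subseteq> verts H"
    using assms(1) edge_nonempty[OF assms(1)] by (auto simp: finite_simple_graph_def)
  then show ?thesis using 1 by blast
qed auto

definition whiskers :: "'a set \<Rightarrow> ('a + 'a) set set" where
  "whiskers A = (\<lambda>x. {Inl x, Inr x}) ` A"

lemma matching_whiskers:
  assumes "A \<subseteq> verts H" shows "matching (whisker_graph H) (whiskers A)"
  using assms whisker_edge[of _ H]
  by (auto simp: matching_def whiskers_def pairwise_def disjnt_def)

lemma card_whiskers: "card (whiskers A) = card A"
  unfolding whiskers_def by (rule card_image) (auto simp: inj_on_def doubleton_eq_iff)

lemma Union_whiskers: "\<Union>(whiskers A) = Inl ` A \<union> Inr ` A"
  by (auto simp: whiskers_def)

text \<open>The vertices of \<open>H\<close> form a vertex cover of its whisker graph.\<close>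

lemma card_matching_whisker_le:
  assumes "finite_simple_graph H" "matching (whisker_graph H) M"
  shows "card M \<le> card (verts H)"
proof -
  have "card M \<le> card (Inl ` verts H :: ('a + 'a) set)"
    using assms whisker_edge_meets_verts[OF assms(1)]
    by (intro card_matching_le_cover[OF assms(2)])
      (auto simp: matching_def finite_simple_graph_def)
  then show ?thesis by (simp add: card_image)
qed

lemma matching_number_whisker_le:
  assumes "finite_simple_graph H"
  shows "matching_number (whisker_graph H) \<le> card (verts H)"
proof -
  let ?S = "{M. matching (whisker_graph H) M}"
  have "?S \<subseteq> Pow (edges (whisker_graph H))" by (auto simp: matching_def)
  then have "finite ?S"
    using finite_edges[OF finite_simple_graph_whisker[OF assms]] by (metis finite_Pow_iff finite_subset)
  moreover have "{} \<in> ?S" by (auto simp: matching_def)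
  ultimately show ?thesis
    unfolding matching_number_def using card_matching_whisker_le[OF assms]
    by (subst Max_le_iff) auto
qed

text \<open>A leaf has only one neighbour, whereas the two neighbours of a vertex in a cycle are distinct.\<close>

lemma cycle_whisker_vertex_not_Inr:
  assumes c: "cycle (whisker_graph H) c"
  shows "Inr x \<notin> set c"
proof
  assume "Inr x \<in> set c"
  then obtain j where j: "j < length c" "c ! j = Inr x" by (auto simp: in_set_conv_nth)
  define L where "L = length c"
  have L: "3 \<le> L" "distinct c" using c by (auto simp: cycle_def L_def)
  have edge: "{c ! i, c ! (Suc i mod L)} \<in> edges (whisker_graph H)" if "i < L" for i
    using c that by (auto simp: cycle_def L_def)
  \<comment> \<open>The positions before and after \<open>j\<close>; they differ because the length is at least 3.\<close>
  define i k where "i = (if j = 0 then L - 1 else j - 1)" and "k = Suc j mod L"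
  have ik: "i < L" "k < L" "Suc i mod L = j" "i \<noteq> k"
    using L j by (auto simp: i_def k_def L_def mod_Suc split: if_splits)
  have "c ! k = Inl x"
    using whisker_edge_through_Inr[OF edge[of j], of x] j
    by (auto simp: k_def L_def doubleton_eq_iff)
  moreover have "c ! i = Inl x"
    using whisker_edge_through_Inr[OF edge[of i], of x] j ik by (auto simp: doubleton_eq_iff)
  ultimately have "c ! i = c ! k" by simp
  then show False using ik L nth_eq_iff_index_eq unfolding L_def by blast
qed

lemma cycle_whiskerD:
  assumes c: "cycle (whisker_graph H) c"
  obtains c' where "c = map Inl c'" "cycle H c'"
proof -
  have "\<forall>z\<in>set c. z = Inl (projl z)"
    using cycle_whisker_vertex_not_Inr[OF c] by (metis sum.collapse(1) sum.collapse(2))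
  then have c': "c = map Inl (map projl c)" by (simp add: map_idI)
  define d where "d = map projl c"
  have cd: "c = map Inl d" using c' by (simp add: d_def)
  have "cycle H d"
    unfolding cycle_def
  proof (intro conjI allI impI)
    show "3 \<le> length d" "distinct d" using c cd by (auto simp: cycle_def distinct_map)
    show "set d \<subseteq> verts H" using c cd by (auto simp: cycle_def verts_whisker)
    fix i assume i: "i < length d"
    then have "Suc i mod length d < length d" by (intro mod_less_divisor) auto
    moreover have "{c ! i, c ! (Suc i mod length d)} \<in> edges (whisker_graph H)"
      using c i cd by (auto simp: cycle_def)
    ultimately show "{d ! i, d ! (Suc i mod length d)} \<in> edges H"
      using i cd whisker_edge_Inl_iff by (metis nth_map)
  qed
  then show thesis using that cd by blast
qed

section \<open>Facets of the matching-free complex of a whisker graph\<close>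

definition full_pairs :: "('a + 'a) set \<Rightarrow> 'a set" where
  "full_pairs F = {x. Inl x \<in> F \<and> Inr x \<in> F}"

lemma card_eq_full_pairs:
  assumes "finite V" "F \<subseteq> Inl ` V \<union> Inr ` V" "\<And>x. x \<in> V \<Longrightarrow> Inl x \<in> F \<or> Inr x \<in> F"
  shows "card F = card V + card (full_pairs F)"
proof -
  define P Q where "P = {x \<in> V. Inl x \<in> F}" and "Q = {x \<in> V. Inr x \<in> F}"
  have fin: "finite P" "finite Q" using assms by (auto simp: P_def Q_def)
  have F: "F = Inl ` P \<union> Inr ` Q" using assms(2) by (auto simp: P_def Q_def)
  have "card F = card (Inl ` P :: ('a + 'a) set) + card (Inr ` Q :: ('a + 'a) set)"
    unfolding F using fin by (intro card_Un_disjoint) auto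
  also have "\<dots> = card P + card Q" by (simp add: card_image)
  also have "\<dots> = card (P \<union> Q) + card (P \<inter> Q)" using fin by (rule card_Un_Int)
  also have "P \<union> Q = V" using assms(3) by (auto simp: P_def Q_def)
  also have "P \<inter> Q = full_pairs F" using assms(2) by (auto simp: P_def Q_def full_pairs_def)
  finally show ?thesis .
qed

text \<open>If both ends of the whisker at \<open>x\<close> were missing, adding the leaf would have to create a matching edge at
  that leaf inside the enlarged set; but its only edge needs the absent \<open>x\<close>.\<close>

lemma facet_meets_whisker:
  assumes H: "finite_simple_graph H"
    and F: "F \<in> facets (matching_free_complex q (whisker_graph H))" and x: "x \<in> verts H"
  shows "Inl x \<in> F \<or> Inr x \<in> F"
proof (rule ccontr)
  assume n: "\<not> (Inl x \<in> F \<or> Inr x \<in> F)"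
  have "Inr x \<in> verts (whisker_graph H)" using x by (simp add: verts_whisker)
  moreover have "Inr x \<notin> F" using n by simp
  ultimately obtain M e where e: "e \<in> edges (whisker_graph H)" "Inr x \<in> e" "e \<subseteq> insert (Inr x) F"
    by (rule facet_missing_vertex[OF finite_simple_graph_whisker[OF H] F])
  have "Inl x \<in> e" using whisker_edge_through_Inr[OF e(1,2)] by simp
  then show False using e(3) n by auto
qed

lemma card_facet:
  assumes H: "finite_simple_graph H"
    and F: "F \<in> facets (matching_free_complex q (whisker_graph H))"
  shows "card F = card (verts H) + card (full_pairs F)"
proof (rule card_eq_full_pairs)
  show "finite (verts H)" using H by (simp add: finite_simple_graph_def)
  show "F \<subseteq> Inl ` verts H \<union> Inr ` verts H"
    using F by (auto simp: facets_def matching_free_complex_def verts_whisker)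
qed (rule facet_meets_whisker[OF H F])

lemma full_pairs_subset_verts:
  assumes "F \<subseteq> verts (whisker_graph H)" shows "full_pairs F \<subseteq> verts H"
  using assms by (auto simp: full_pairs_def verts_whisker)

lemma card_full_pairs_less:
  assumes H: "finite_simple_graph H" and F: "F \<in> matching_free_complex q (whisker_graph H)"
  shows "card (full_pairs F) < q"
proof -
  have sub: "full_pairs F \<subseteq> verts H"
    using F by (intro full_pairs_subset_verts) (simp add: matching_free_complex_def)
  have "\<Union>(whiskers (full_pairs F)) \<subseteq> F" unfolding Union_whiskers by (auto simp: full_pairs_def)
  then have "card (whiskers (full_pairs F)) < q"
    using F matching_whiskers[OF sub] matching_free_complex_iff[OF finite_simple_graph_whisker[OF H]]
    by blast
  then show ?thesis by (simp add: card_whiskers)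
qed

text \<open>A facet that attains the largest possible number of full pairs: here \<open>A\<close> is a vertex cover of the
  induced subgraph, and any further vertex of \<open>H\<close> brings its whisker with it.\<close>

lemma standard_facet:
  assumes H: "finite_simple_graph H" and A: "A \<subseteq> verts H" "Suc (card A) = q"
  shows "Inr ` verts H \<union> Inl ` A \<in> facets (matching_free_complex q (whisker_graph H))"
proof -
  let ?G = "whisker_graph H" and ?F = "Inr ` verts H \<union> Inl ` A"
  note G = finite_simple_graph_whisker[OF H]
  have finA: "finite A" using A H finite_subset by (auto simp: finite_simple_graph_def)
  show ?thesis
  proof (rule facetI[OF G])
    have "card M < q" if M: "matching ?G M" "\<Union>M \<subseteq> ?F" for M
    proof -
      have "card M \<le> card (Inl ` A :: ('a + 'a) set)"
      proof (rule card_matching_le_cover[OF M(1)])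
        fix e assume e: "e \<in> M"
        then have "e \<in> edges ?G" using M by (auto simp: matching_def)
        from whisker_edge_meets_verts[OF H this] show "e \<inter> Inl ` A \<noteq> {}" using M e by blast
      qed (use finA in simp)
      then show ?thesis using A by (simp add: card_image)
    qed
    then show "?F \<in> matching_free_complex q ?G"
      using A by (auto simp: matching_free_complex_iff[OF G] verts_whisker)
  next
    fix z assume z: "z \<in> verts ?G - ?F"
    then obtain x where x: "z = Inl x" "x \<in> verts H" "x \<notin> A" by (auto simp: verts_whisker)
    have "matching ?G (whiskers (insert x A))" using matching_whiskers[of "insert x A" H] x A by simp
    moreover have "\<Union>(whiskers (insert x A)) \<subseteq> insert z ?F" using x A by (auto simp: Union_whiskers)
    moreover have "card (whiskers (insert x A)) = q" using x A finA by (simp add: card_whiskers)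
    ultimately show "\<exists>M. matching ?G M \<and> \<Union>M \<subseteq> insert z ?F \<and> q \<le> card M" by blast
  qed
qed

lemma pure_iff_full_pairs:
  assumes H: "finite_simple_graph H" and q: "1 \<le> q" "q \<le> card (verts H)"
  shows "pure_complex (matching_free_complex q (whisker_graph H)) \<longleftrightarrow>
    (\<forall>F \<in> facets (matching_free_complex q (whisker_graph H)). Suc (card (full_pairs F)) = q)"
    (is "?L \<longleftrightarrow> (\<forall>F \<in> ?Fs. _)")
proof
  assume ?L
  have "q - 1 \<le> card (verts H)" using q by simp
  then obtain A where A: "A \<subseteq> verts H" "card A = q - 1" by (metis obtain_subset_with_card_n)
  let ?F0 = "Inr ` verts H \<union> Inl ` A :: ('a + 'a) set"
  have F0: "?F0 \<in> ?Fs" using standard_facet[OF H A(1)] A q by simp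
  have "full_pairs ?F0 = A" using A by (auto simp: full_pairs_def)
  show "\<forall>F \<in> ?Fs. Suc (card (full_pairs F)) = q"
  proof
    fix F assume F: "F \<in> ?Fs"
    have "card F = card ?F0"
      using \<open>?L\<close> F F0 unfolding pure_complex_def face_dim_def by fastforce
    then show "Suc (card (full_pairs F)) = q"
      using card_facet[OF H F] card_facet[OF H F0] \<open>full_pairs ?F0 = A\<close> A q by simp
  qed
next
  assume *: "\<forall>F \<in> ?Fs. Suc (card (full_pairs F)) = q"
  show ?L
    unfolding pure_complex_def face_dim_def
  proof (intro ballI)
    fix F F' assume F: "F \<in> ?Fs" "F' \<in> ?Fs"
    have "Suc (card (full_pairs F)) = Suc (card (full_pairs F'))" using bspec[OF * F(1)] bspec[OF * F(2)] by simp
    then show "int (card F) - 1 = int (card F') - 1"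
      using card_facet[OF H F(1)] card_facet[OF H F(2)] by simp
  qed
qed

text \<open>If no two vertices without their leaves were adjacent, the full pairs would cover all edges inside \<open>F\<close>.
  But \<open>F\<close> contains a matching with \<open>q - 1\<close> edges, which is more than the number of full pairs.\<close>

lemma small_facet_adjacent_pair:
  assumes H: "finite_simple_graph H" and q: "q \<le> card (verts H)"
    and F: "F \<in> facets (matching_free_complex q (whisker_graph H))"
    and small: "Suc (card (full_pairs F)) \<noteq> q"
  obtains x y where "{x, y} \<in> edges H" "Inl x \<in> F" "Inl y \<in> F" "Inr x \<notin> F" "Inr y \<notin> F"
proof (rule ccontr)
  assume neg: "\<not> thesis"
  let ?G = "whisker_graph H" and ?A = "full_pairs F"
  note G = finite_simple_graph_whisker[OF H]
  have FK: "F \<in> matching_free_complex q ?G" using F by (simp add: facets_def)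
  then have FV: "F \<subseteq> verts ?G" by (simp add: matching_free_complex_def)
  have AV: "?A \<subseteq> verts H" using full_pairs_subset_verts[OF FV] .
  have finA: "finite ?A" using AV H finite_subset by (auto simp: finite_simple_graph_def)
  have less: "Suc (card ?A) < q" using card_full_pairs_less[OF H FK] small by simp
  \<comment> \<open>Some vertex lies outside the facet, and adding it reveals the matching with \<open>q - 1\<close> edges.\<close>
  have "?A \<noteq> verts H" using less q by auto
  then obtain z where z: "z \<in> verts ?G" "z \<notin> F"
    using AV by (auto simp: full_pairs_def verts_whisker)
  obtain M where M: "matching ?G M" "\<Union>M \<subseteq> F" "Suc (card M) = q"
    by (rule facet_missing_vertex[OF G F z])
  have "card M \<le> card (Inl ` ?A :: ('a + 'a) set)"
  proof (rule card_matching_le_cover[OF M(1)])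
    fix e assume e: "e \<in> M"
    then have eF: "e \<subseteq> F" and "e \<in> edges ?G" using M by (auto simp: matching_def)
    from this(2) show "e \<inter> Inl ` ?A \<noteq> {}"
    proof (cases rule: whisker_edge_cases)
      case (1 e')
      then have "card e' = 2" using H by (auto simp: finite_simple_graph_def)
      then obtain x y where xy: "e' = {x, y}" by (auto simp: card_2_iff)
      then have "Inr x \<in> F \<or> Inr y \<in> F" using neg that[of x y] 1 eF by auto
      then show ?thesis using 1 xy eF by (auto simp: full_pairs_def)
    next
      case (2 x)
      then show ?thesis using eF by (auto simp: full_pairs_def)
    qed
  qed (use finA in simp)
  then show False using M less by (simp add: card_image)
qed

text \<open>The new edge that appears when the leaf of \<open>x\<close> is added to \<open>F\<close> is the whisker at \<open>x\<close>; so the other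
  \<open>q - 1\<close> edges miss \<open>x\<close>.\<close>

lemma facet_matching_missing_vertex:
  assumes H: "finite_simple_graph H"
    and F: "F \<in> facets (matching_free_complex q (whisker_graph H))"
    and x: "Inl x \<in> F" "Inr x \<notin> F"
  obtains M where "matching (whisker_graph H) M" "\<Union>M \<subseteq> F" "Suc (card M) = q" "Inl x \<notin> \<Union>M"
proof -
  have "Inl x \<in> verts (whisker_graph H)" using F x by (auto simp: facets_def matching_free_complex_def)
  then have "Inr x \<in> verts (whisker_graph H)" by (auto simp: verts_whisker)
  from facet_missing_vertex[OF finite_simple_graph_whisker[OF H] F this x(2)]
  obtain M e where M: "matching (whisker_graph H) M" "\<Union>M \<subseteq> F" "Suc (card M) = q"
    and e: "e \<in> edges (whisker_graph H)" "Inr x \<in> e" "e \<inter> \<Union>M = {}" .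
  have "Inl x \<in> e" using whisker_edge_through_Inr[OF e(1,2)] by simp
  then show thesis using that M e by blast
qed

section \<open>Odd cycles and purity\<close>

text \<open>Every edge of \<open>M\<close> uses a vertex of \<open>H\<close>, the edges in \<open>P\<close> are not whiskers and use two, and \<open>u\<close> is
  used by none.\<close>

lemma card_matching_whisker_missing_vertex:
  assumes H: "finite_simple_graph H" and M: "matching (whisker_graph H) M"
    and u: "u \<in> verts H" "Inl u \<notin> \<Union>M" and P: "P \<subseteq> M" "\<Union>P \<subseteq> range Inl"
  shows "card M + card P < card (verts H)"
proof -
  let ?G = "whisker_graph H" and ?X = "Inl ` verts H :: ('a + 'a) set"
  note G = finite_simple_graph_whisker[OF H]
  have finX: "finite ?X" using H by (simp add: finite_simple_graph_def)
  have finM: "finite M" using matching_finite[OF G M] .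
  have finP: "finite P" using finM P finite_subset by blast
  have ge: "card (e \<inter> ?X) \<ge> 1 + (if e \<in> P then 1 else 0)" if e: "e \<in> M" for e
  proof -
    have eG: "e \<in> edges ?G" using M e by (auto simp: matching_def)
    show ?thesis
    proof (cases "e \<in> P")
      case True
      have "e \<subseteq> verts ?G" "card e = 2" using eG G by (auto simp: finite_simple_graph_def)
      moreover have "e \<subseteq> range Inl" using P True by blast
      ultimately have "e \<inter> ?X = e" "card e = 2" by (auto simp: verts_whisker)
      then show ?thesis by simp
    next
      case False
      have "card (e \<inter> ?X) \<noteq> 0" using whisker_edge_meets_verts[OF H eG] finX by simp
      then show ?thesis using False by simp
    qed
  qed
  have "card M + card P = (\<Sum>e\<in>M. 1 + (if e \<in> P then 1 else 0))"
    unfolding sum.distrib using finM P by (simp add: sum.If_cases Int_absorb1)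
  also have "\<dots> \<le> (\<Sum>e\<in>M. card (e \<inter> ?X))" using ge by (intro sum_mono)
  also have "\<dots> = card (\<Union>M \<inter> ?X)" using card_Union_matching[OF G M] by simp
  also have "\<dots> < card ?X" using u finX by (intro psubset_card_mono) blast+
  also have "\<dots> = card (verts H)" by (simp add: card_image)
  finally show ?thesis .
qed

text \<open>A facet with too few full pairs contains an edge of \<open>H\<close> whose ends are missed by maximum matchings \<open>M\<close>
  and \<open>N\<close>. The edges of \<open>M\<close> on the resulting odd cycle give both bounds on \<open>m\<close>: there are \<open>m\<close> of them among
  the \<open>q - 1\<close> edges of \<open>M\<close>, and each uses two vertices of \<open>H\<close>.\<close>

lemma odd_cycle_of_not_pure:
  assumes H: "finite_simple_graph H" and q: "1 \<le> q" "q \<le> card (verts H)"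
    and np: "\<not> pure_complex (matching_free_complex q (whisker_graph H))"
  shows "\<exists>c m. cycle H c \<and> length c = 2 * m + 1 \<and> m < q \<and> q + m \<le> card (verts H)"
proof -
  let ?G = "whisker_graph H"
  note G = finite_simple_graph_whisker[OF H]
  obtain F where F: "F \<in> facets (matching_free_complex q ?G)" "Suc (card (full_pairs F)) \<noteq> q"
    using np pure_iff_full_pairs[OF H q] by blast
  obtain x y where xy: "{x, y} \<in> edges H" "Inl x \<in> F" "Inl y \<in> F" "Inr x \<notin> F" "Inr y \<notin> F"
    by (rule small_facet_adjacent_pair[OF H q(2) F])
  have FK: "F \<in> matching_free_complex q ?G" using F by (simp add: facets_def)
  let ?GF = "induced_subgraph ?G F"
  have GF: "finite_simple_graph ?GF"
    using finite_simple_graph_induced[OF G] FK by (simp add: matching_free_complex_def)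
  obtain M where M: "matching ?G M" "\<Union>M \<subseteq> F" "Suc (card M) = q" "Inl x \<notin> \<Union>M"
    by (rule facet_matching_missing_vertex[OF H F(1) xy(2,4)])
  obtain N where N: "matching ?G N" "\<Union>N \<subseteq> F" "Suc (card N) = q" "Inl y \<notin> \<Union>N"
    by (rule facet_matching_missing_vertex[OF H F(1) xy(3,5)])
  have maximum: "card M' \<le> card M" if "matching ?GF M'" for M'
  proof -
    have "card M' < q"
      using that FK unfolding matching_free_complex_iff[OF G] matching_induced_iff by blast
    then show ?thesis using M(3) by simp
  qed
  have edge: "{Inl x, Inl y} \<in> edges ?GF"
    using xy whisker_edge_Inl_iff[of x y H] by (simp add: induced_subgraph_def)
  have MF: "matching ?GF M" and NF: "matching ?GF N" "card N = card M"
    using M N by (auto simp: matching_induced_iff)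
  obtain p where p: "cycle ?GF (Inl x # p)" "even (length p)" "pair_up p \<subseteq> M"
    by (rule odd_cycle_of_missed_adjacent[OF GF edge MF refl M(4) NF N(4) maximum])
  have "cycle ?G (Inl x # p)"
    using p(1) FK by (auto simp: cycle_def induced_subgraph_def matching_free_complex_def)
  then obtain c where c: "Inl x # p = map Inl c" "cycle H c" by (rule cycle_whiskerD)
  define m where "m = length p div 2"
  have "length c = length (Inl x # p)" using c by simp
  then have len: "length c = 2 * m + 1" using p(2) by (simp add: m_def)
  have card: "card (pair_up p) = m"
    using card_pair_up p(1) by (auto simp: cycle_def m_def)
  have "m < q" using card card_mono[OF matching_finite[OF G M(1)] p(3)] M(3) by simp
  moreover have "q + m \<le> card (verts H)"
  proof -
    have "x \<in> verts H" using xy H by (auto simp: finite_simple_graph_def)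
    moreover have "set p \<subseteq> range Inl" using c by (cases c) auto
    then have "\<Union>(pair_up p) \<subseteq> range Inl" using Union_pair_up_subset[of p] by blast
    ultimately show ?thesis
      using card_matching_whisker_missing_vertex[OF H M(1) _ M(4) p(3)] card M(3) by simp
  qed
  ultimately show ?thesis using c(2) len by (intro exI conjI)
qed

lemma card_matching_odd_set:
  assumes "finite_simple_graph G" "matching G M" "\<Union>M \<subseteq> S" "finite S" "card S = 2 * k + 1"
  shows "card M \<le> k"
proof -
  have "(\<Sum>e\<in>M. card (e \<inter> S)) = (\<Sum>e\<in>M. 2)"
  proof (rule sum.cong)
    fix e assume "e \<in> M"
    then have "e \<inter> S = e" "card e = 2"
      using assms by (auto simp: finite_simple_graph_def matching_def)
    then show "card (e \<inter> S) = 2" by simp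
  qed simp
  then have "2 * card M = card (\<Union>M \<inter> S)" using card_Union_matching[OF assms(1,2)] by simp
  also have "\<dots> \<le> card S" using assms by (intro card_mono) auto
  finally show ?thesis using assms by simp
qed

text \<open>The facet built from the cycle has only \<open>q - 1 - k\<close> full pairs, because the cycle supplies the other
  \<open>k\<close> edges of a maximum matching without using any leaves.\<close>

lemma not_pure_of_odd_cycle:
  assumes H: "finite_simple_graph H" and c: "cycle H c" "length c = 2 * k + 1"
    and q: "k < q" "q + k \<le> card (verts H)"
  shows "\<not> pure_complex (matching_free_complex q (whisker_graph H))"
proof -
  let ?G = "whisker_graph H" and ?V = "verts H" and ?B = "set c"
  note G = finite_simple_graph_whisker[OF H]
  have finV: "finite ?V" using H by (simp add: finite_simple_graph_def)
  have B: "?B \<subseteq> ?V" "card ?B = 2 * k + 1" and "1 \<le> k"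
    using c by (auto simp: cycle_def distinct_card)
  have "q - 1 - k \<le> card (?V - ?B)" using B q finV by (simp add: card_Diff_subset)
  then obtain A where A: "A \<subseteq> ?V - ?B" "card A = q - 1 - k" by (metis obtain_subset_with_card_n)
  have finA: "finite A" using A finV finite_subset by blast
  have cardA: "card A + k + 1 = q" using A q by simp
  define F :: "('a + 'a) set" where "F = Inr ` (?V - ?B) \<union> Inl ` (A \<union> ?B)"
  have FV: "F \<subseteq> verts ?G" using A B by (auto simp: F_def verts_whisker)
  have bound: "card M < q" if M: "matching ?G M" "\<Union>M \<subseteq> F" for M
  proof -
    \<comment> \<open>Split \<open>M\<close> into the edges at \<open>A\<close> and the edges inside the cycle.\<close>
    define MA where "MA = {e \<in> M. e \<inter> Inl ` A \<noteq> {}}"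
    have mA: "matching ?G MA" and mB: "matching ?G (M - MA)"
      using matching_subset[OF M(1)] by (auto simp: MA_def)
    have "card MA \<le> card (Inl ` A :: ('a + 'a) set)"
      using finA by (intro card_matching_le_cover[OF mA]) (auto simp: MA_def)
    then have cA: "card MA \<le> card A" by (simp add: card_image)
    have "\<Union>(M - MA) \<subseteq> Inl ` ?B"
    proof
      fix z assume "z \<in> \<Union>(M - MA)"
      then obtain e where e: "e \<in> M" "e \<inter> Inl ` A = {}" "z \<in> e" by (auto simp: MA_def)
      have eG: "e \<in> edges ?G" "e \<subseteq> F" using M e by (auto simp: matching_def)
      from eG(1) show "z \<in> Inl ` ?B"
      proof (cases rule: whisker_edge_cases)
        case 1
        have "z \<in> F" "z \<notin> Inl ` A" using e eG by blast+
        moreover have "z \<in> range Inl" using 1 e by blast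
        ultimately show ?thesis by (auto simp: F_def)
      next
        case 2 then show ?thesis using e eG by (auto simp: F_def)
      qed
    qed
    then have "card (M - MA) \<le> k"
      using B(2) by (intro card_matching_odd_set[OF G mB]) (auto simp: card_image)
    moreover have "card M = card MA + card (M - MA)"
      using matching_finite[OF G M(1)] by (auto simp: MA_def card_Diff_subset card_mono)
    ultimately show ?thesis using cA cardA by simp
  qed
  have extend: "\<exists>M. matching ?G M \<and> \<Union>M \<subseteq> insert z F \<and> q \<le> card M" if z: "z \<in> verts ?G - F" for z
  proof -
    \<comment> \<open>Adding \<open>z\<close> completes the whisker at \<open>x\<close>. If \<open>x\<close> is on the cycle, it is the vertex \<open>b\<close> to be left
      out of the near-perfect matching of the cycle; otherwise any \<open>b\<close> will do.\<close>
    obtain x b where x: "x \<in> ?V - A" "Inl x \<in> insert z F" "Inr x \<in> insert z F"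
      and b: "b \<in> ?B" "x \<notin> ?B - {b}"
    proof -
      obtain b0 where b0: "b0 \<in> ?B" using c by (cases c) auto
      consider (l) x where "z = Inl x" "x \<in> ?V" "x \<notin> A" "x \<notin> ?B" | (r) x where "z = Inr x" "x \<in> ?B"
        using z by (auto simp: F_def verts_whisker)
      then show thesis
      proof cases
        case l then show thesis using that[of x b0] b0 by (auto simp: F_def)
      next
        case r then show thesis using that[of x x] A B by (auto simp: F_def)
      qed
    qed
    obtain p where p: "distinct p" "set p = ?B - {b}" "successively (\<lambda>x y. {x, y} \<in> edges H) p"
        "length p = length c - 1"
      by (rule cycle_path_avoiding_vertex[OF c(1) b(1)])
    define P :: "('a + 'a) set set" where "P = pair_up (map Inl p)"
    have P: "matching ?G P" "card P = k"
      using matching_pair_up[OF G, of "map Inl p"] p c(2)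
      by (auto simp: P_def distinct_map successively_map whisker_edge_Inl_iff)
    have UP: "\<Union>P \<subseteq> Inl ` (?B - {b})"
      using Union_pair_up_subset[of "map Inl p"] p(2) by (simp add: P_def)
    let ?W = "whiskers (insert x A)"
    have W: "matching ?G ?W" "card ?W = card A + 1"
      using matching_whiskers[of "insert x A" H] x A finA by (auto simp: card_whiskers)
    have UW: "\<Union>?W = Inl ` insert x A \<union> Inr ` insert x A" by (rule Union_whiskers)
    have disj: "\<Union>?W \<inter> \<Union>P = {}" using UP UW b A by auto
    have "\<Union>(?W \<union> P) \<subseteq> insert z F" using UP UW x A by (auto simp: F_def)
    then show ?thesis
      using matching_Un[OF W(1) P(1) disj] card_matching_Un[OF G W(1) P(1) disj] W P cardA
      by (intro exI[of _ "?W \<union> P"]) simp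
  qed
  have "F \<in> facets (matching_free_complex q ?G)"
    using FV bound extend by (intro facetI[OF G]) (auto simp: matching_free_complex_iff[OF G])
  moreover have "full_pairs F = A" using A by (auto simp: full_pairs_def F_def)
  then have "Suc (card (full_pairs F)) \<noteq> q" using cardA \<open>1 \<le> k\<close> by simp
  moreover have "1 \<le> q" "q \<le> card ?V" using q by simp_all
  ultimately show ?thesis using pure_iff_full_pairs[OF H] by blast
qed

theorem theorem1p1:
  fixes H :: "'a graph" and G :: "('a + 'a) graph" and n q :: nat
  assumes "finite_simple_graph H"
    and "card (verts H) = n"
    and "G = whisker_graph H"
    and "1 \<le> q" and "q \<le> matching_number G"
  shows "(\<not> has_odd_cycle H \<longrightarrow> pure_complex (matching_free_complex q G)) \<and>
    (has_odd_cycle H \<longrightarrow>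
      (\<forall>l. l = odd_girth H \<longrightarrow>
        (pure_complex (matching_free_complex q G) \<longleftrightarrow>
          1 \<le> q \<and> int q < \<lceil>real l / 2\<rceil> \<or>
          int n - \<lfloor>real l / 2\<rfloor> < int q \<and> q \<le> matching_number G)))"
proof -
  have qn: "q \<le> card (verts H)" using assms matching_number_whisker_le[OF assms(1)] by simp
  have cyc: "\<exists>c m. cycle H c \<and> length c = 2 * m + 1 \<and> m < q \<and> q + m \<le> n"
    if "\<not> pure_complex (matching_free_complex q G)"
    using odd_cycle_of_not_pure[OF assms(1,4) qn] that unfolding assms(2,3) .
  show ?thesis
  proof (intro conjI impI allI)
    assume even: "\<not> has_odd_cycle H"
    show "pure_complex (matching_free_complex q G)"
    proof (rule ccontr)
      assume "\<not> pure_complex (matching_free_complex q G)"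
      from cyc[OF this] obtain c m where "cycle H c" "length c = 2 * m + 1" by blast
      moreover from this have "odd (length c)" by simp
      ultimately show False using even unfolding has_odd_cycle_def by blast
    qed
  next
    fix l assume odd: "has_odd_cycle H" and l: "l = odd_girth H"
    let ?is_len = "\<lambda>l. \<exists>c. cycle H c \<and> odd (length c) \<and> length c = l"
    have l_def: "l = (LEAST l. ?is_len l)" using l by (simp only: odd_girth_def)
    have "\<exists>l. ?is_len l" using odd unfolding has_odd_cycle_def by blast
    then have "?is_len l" unfolding l_def by (rule LeastI_ex)
    then obtain c where c': "cycle H c" "odd l" "length c = l" by blast
    from c'(2) obtain k where "l = 2 * k + 1" by (rule oddE)
    with c' have c: "cycle H c" "length c = l" "l = 2 * k + 1" by simp_all
    have least: "k \<le> m" if "cycle H d" "length d = 2 * m + 1" for d m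
    proof -
      have "odd (length d)" using that(2) by simp
      then have "?is_len (2 * m + 1)" using that by blast
      then have "l \<le> 2 * m + 1" unfolding l_def by (rule Least_le)
      then show ?thesis using c by simp
    qed
    have "pure_complex (matching_free_complex q G) \<longleftrightarrow> \<not> (k < q \<and> q + k \<le> n)"
    proof
      assume "pure_complex (matching_free_complex q G)"
      then show "\<not> (k < q \<and> q + k \<le> n)"
        using not_pure_of_odd_cycle[OF assms(1) c(1), of k q] c(2,3)
        unfolding assms(2) assms(3)[symmetric] by blast
    next
      assume out: "\<not> (k < q \<and> q + k \<le> n)"
      show "pure_complex (matching_free_complex q G)"
      proof (rule ccontr)
        assume "\<not> pure_complex (matching_free_complex q G)"
        from cyc[OF this]
        obtain d m where d: "cycle H d" "length d = 2 * m + 1" "m < q" "q + m \<le> n" by blast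
        then show False using least[OF d(1,2)] out by simp
      qed
    qed
    moreover have "\<lceil>real l / 2\<rceil> = int k + 1" "\<lfloor>real l / 2\<rfloor> = int k"
      using c(3) by (intro ceiling_unique floor_unique; simp)+
    ultimately show "pure_complex (matching_free_complex q G) \<longleftrightarrow>
          1 \<le> q \<and> int q < \<lceil>real l / 2\<rceil> \<or>
          int n - \<lfloor>real l / 2\<rfloor> < int q \<and> q \<le> matching_number G"
      using assms(4,5) by auto
  qed
qed

end
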